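(* Let $G$ and $H$ be two graphs with disjoint vertex sets, and let $G+H$ be their join. Then $$mp(G)+mp(H)\leq mp(G+H)\leq |V(G)|+|V(H)|,$$ and both bounds are sharp, that is, for each of the two inequalities there exist graphs $G$ and $H$ for which equality holds.
   Context: All graphs are finite, simple, undirected, with non-empty vertex set. A path $v_1v_2\ldots v_k$ (distinct vertices, consecutive ones adjacent, $k\ge 1$) in a graph $G$ is degree monotone if $\deg(v_1)\le \deg(v_2)\le\dots\le\deg(v_k)$ or $\deg(v_1)\ge\deg(v_2)\ge\dots\ge\deg(v_k)$, where degrees are taken in $G$. The length of a degree monotone path is its number of vertices, and $mp(G)$ is the maximum length of a degree monotone path in $G$. The join $G+H$ of graphs $G$ and $H$ with disjoint vertex sets is the graph with $V(G+H)=V(G)\cup V(H)$ and $E(G+H)=E(G)\cup E(H)\cup\{xy: x\in V(G),\, y\in V(H)\}$. *)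

theory Defs
  imports Main
begin

record 'a graph =
  verts :: "'a set"
  edges :: "'a set set"

definition simple_graph :: "'a graph \<Rightarrow> bool" where
  "simple_graph G \<longleftrightarrow>
     finite (verts G) \<and> verts G \<noteq> {} \<and>
     (\<forall>e\<in>edges G. e \<subseteq> verts G \<and> card e = 2)"

definition adj :: "'a graph \<Rightarrow> 'a \<Rightarrow> 'a \<Rightarrow> bool" where
  "adj G x y \<longleftrightarrow> {x, y} \<in> edges G"

definition degree :: "'a graph \<Rightarrow> 'a \<Rightarrow> nat" where
  "degree G x = card {y \<in> verts G. adj G x y}"

definition path :: "'a graph \<Rightarrow> 'a list \<Rightarrow> bool" where
  "path G p \<longleftrightarrow> p \<noteq> [] \<and> set p \<subseteq> verts G \<and> distinct p \<and> successively (adj G) p"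

definition degree_monotone_path :: "'a graph \<Rightarrow> 'a list \<Rightarrow> bool" where
  "degree_monotone_path G p \<longleftrightarrow> path G p \<and>
     (sorted_wrt (\<le>) (map (degree G) p) \<or> sorted_wrt (\<ge>) (map (degree G) p))"

definition mp :: "'a graph \<Rightarrow> nat" where
  "mp G = Max {length p | p. degree_monotone_path G p}"

definition join :: "'a graph \<Rightarrow> 'a graph \<Rightarrow> 'a graph" where
  "join G H =
     \<lparr> verts = verts G \<union> verts H,
       edges = edges G \<union> edges H \<union> {{x, y} | x y. x \<in> verts G \<and> y \<in> verts H} \<rparr>"

lemma simple_graph_join:
  assumes "simple_graph G" "simple_graph H" "verts G \<inter> verts H = {}"
  shows "simple_graph (join G H)"
proof -
  have "card {x, y} = 2" if "x \<in> verts G" "y \<in> verts H" for x y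
    proof -
    have "x \<noteq> y" using that assms(3) by blast
    then show ?thesis by simp
  qed
  then show ?thesis
    using assms(1,2) unfolding simple_graph_def join_def by auto
qed

text \<open>The maximum defining \<^const>\<open>mp\<close> ranges over a finite non-empty set.\<close>

lemma finite_degree_monotone_path_lengths:
  assumes "simple_graph G"
  shows "finite {length p | p. degree_monotone_path G p}"
proof (rule finite_subset)
  show "{length p | p. degree_monotone_path G p} \<subseteq> {..card (verts G)}"
    using assms
    by (auto simp: degree_monotone_path_def path_def simple_graph_def
        simp flip: distinct_card intro!: card_mono)
qed simp

lemma degree_monotone_path_lengths_nonempty:
  assumes "simple_graph G"
  shows "{length p | p. degree_monotone_path G p} \<noteq> {}"
proof -
  obtain v where "v \<in> verts G"
    using assms by (auto simp: simple_graph_def)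
  then have "degree_monotone_path G [v]"
    by (simp add: degree_monotone_path_def path_def)
  then show ?thesis by blast
qed

end

theory Submission
  imports Defs
begin

text \<open>
  Joining adds \<open>card (verts H)\<close> to every degree in \<open>G\<close> and \<open>card (verts G)\<close> to every degree in
  \<open>H\<close>, so degree monotone paths of \<open>G\<close> and \<open>H\<close>, both oriented upwards, stay monotone in the join.
  Merging them by degree gives a path: neighbours in the merged list either were consecutive in one
  of the two paths or lie on different sides of the join. Both bounds are attained by two
  single-vertex graphs.
\<close>

text \<open>The merge step of merge sort: the head with the smaller \<open>f\<close>-value goes
  first. It bounds the rest of its own list by sortedness and the other list through that list's
  head.\<close>

lemma exists_sorted_shuffle:
  fixes f :: "'a \<Rightarrow> 'b::linorder"
  assumes "sorted (map f xs)" "sorted (map f ys)"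
  shows "\<exists>zs\<in>shuffles xs ys. sorted (map f zs)"
  using assms
proof (induction xs ys rule: shuffles.induct)
  case (3 x xs y ys)
  show ?case
  proof (cases "f x \<le> f y")
    case True
    obtain zs where zs: "zs \<in> shuffles xs (y # ys)" "sorted (map f zs)"
      using "3.IH"(1) "3.prems" by auto
    have "sorted (map f (x # zs))"
      using zs(2) "3.prems" True by (force simp: set_shuffles[OF zs(1)])
    then show ?thesis
      using zs(1) by (intro bexI[of _ "x # zs"]) auto
  next
    case False
    obtain zs where zs: "zs \<in> shuffles (x # xs) ys" "sorted (map f zs)"
      using "3.IH"(2) "3.prems" by auto
    have "sorted (map f (y # zs))"
      using zs(2) "3.prems" False by (force simp: set_shuffles[OF zs(1)])
    then show ?thesis
      using zs(1) by (intro bexI[of _ "y # zs"]) auto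
  qed
qed auto

lemma hd_shuffles:
  assumes "zs \<in> shuffles xs ys" "zs \<noteq> []"
  shows "xs \<noteq> [] \<and> hd zs = hd xs \<or> ys \<noteq> [] \<and> hd zs = hd ys"
  using assms by (cases xs; cases ys) auto

text \<open>Two neighbours in a shuffle that come from the same list are consecutive there, because
  a shuffle keeps the order of each list. Neighbours from different lists are related by the cross
  hypothesis, in either order.\<close>

lemma successively_shuffles:
  assumes "zs \<in> shuffles xs ys" "successively R xs" "successively R ys"
    and "\<And>x y. x \<in> set xs \<Longrightarrow> y \<in> set ys \<Longrightarrow> R x y \<and> R y x"
  shows "successively R zs"
  using assms
proof (induction xs ys arbitrary: zs rule: shuffles.induct)
  case (3 x xs y ys)
  consider ws where "zs = x # ws" "ws \<in> shuffles xs (y # ys)"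
    | ws where "zs = y # ws" "ws \<in> shuffles (x # xs) ys"
    using "3.prems"(1) by auto
  then show ?case
  proof cases
    case 1
    have "successively R ws"
      using "3.IH"(1)[OF 1(2)] "3.prems" by (auto simp: successively_Cons)
    \<comment> \<open>\<open>hd ws\<close> is either the successor of \<open>x\<close> in its own
      list or the head \<open>y\<close> of the other list.\<close>
    moreover have "R x (hd ws)" if "ws \<noteq> []"
      using hd_shuffles[OF 1(2) that] "3.prems" by (auto simp: successively_Cons)
    ultimately show ?thesis
      using 1(1) by (auto simp: successively_Cons)
  next
    case 2
    have "successively R ws"
      using "3.IH"(2)[OF 2(2)] "3.prems" by (auto simp: successively_Cons)
    moreover have "R y (hd ws)" if "ws \<noteq> []"
      using hd_shuffles[OF 2(2) that] "3.prems" by (auto simp: successively_Cons)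
    ultimately show ?thesis
      using 2(1) by (auto simp: successively_Cons)
  qed
qed auto

lemma adj_commute: "adj G x y \<longleftrightarrow> adj G y x"
  by (simp add: adj_def insert_commute)

text \<open>A path with decreasing degrees can be reversed, since adjacency is symmetric. This gives
  the two paths to be merged the same orientation.\<close>

lemma degree_monotone_path_increasing:
  assumes "degree_monotone_path G p"
  obtains q where "path G q" "sorted (map (degree G) q)" "length q = length p"
proof (cases "sorted (map (degree G) p)")
  case True
  then show ?thesis
    using that assms by (auto simp: degree_monotone_path_def)
next
  case False
  then have "path G p" "sorted_wrt (\<ge>) (map (degree G) p)"
    using assms by (auto simp: degree_monotone_path_def)
  then have "path G (rev p)" "sorted (map (degree G) (rev p))"
    by (simp_all add: path_def sorted_wrt_rev flip: rev_map adj_commute)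
  then show ?thesis
    using that by simp
qed

lemma mp_attained:
  assumes "simple_graph G"
  obtains p where "path G p" "sorted (map (degree G) p)" "length p = mp G"
proof -
  have "mp G \<in> {length p | p. degree_monotone_path G p}"
    unfolding mp_def using assms
    by (intro Max_in finite_degree_monotone_path_lengths degree_monotone_path_lengths_nonempty)
  then show ?thesis
    using that degree_monotone_path_increasing by (smt (verit) mem_Collect_eq)
qed

lemma length_le_mp:
  assumes "simple_graph G" "degree_monotone_path G p"
  shows "length p \<le> mp G"
  unfolding mp_def
  using assms by (auto intro!: Max_ge finite_degree_monotone_path_lengths)

lemma mp_pos: "simple_graph G \<Longrightarrow> 0 < mp G"
  by (metis mp_attained path_def length_greater_0_conv)

lemma mp_le_card_verts:
  assumes "simple_graph G"
  shows "mp G \<le> card (verts G)"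
proof -
  obtain p where "path G p" "length p = mp G"
    using mp_attained[OF assms] .
  then show ?thesis
    using assms by (metis path_def simple_graph_def card_mono distinct_card)
qed

lemma join_commute: "join G H = join H G"
  by (auto simp: join_def)

lemma adj_in_verts:
  assumes "simple_graph G" "adj G x y"
  shows "x \<in> verts G" "y \<in> verts G"
  using assms by (auto simp: simple_graph_def adj_def)

lemma adj_join:
  "adj (join G H) x y \<longleftrightarrow> adj G x y \<or> adj H x y \<or>
     x \<in> verts G \<and> y \<in> verts H \<or> y \<in> verts G \<and> x \<in> verts H"
  by (auto simp: adj_def join_def doubleton_eq_iff)

text \<open>The neighbours of \<open>x\<close> in the join are its old neighbours together with all
  of \<open>verts H\<close>. Edges of \<open>H\<close> contribute nothing more, since they stay
  inside \<open>verts H\<close>, which does not contain \<open>x\<close>.\<close>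

lemma degree_join:
  assumes "simple_graph G" "simple_graph H" "verts G \<inter> verts H = {}" "x \<in> verts G"
  shows "degree (join G H) x = degree G x + card (verts H)"
proof -
  have "{y \<in> verts (join G H). adj (join G H) x y} = {y \<in> verts G. adj G x y} \<union> verts H"
    using assms adj_in_verts[of G] adj_in_verts[of H] unfolding adj_join by (auto simp: join_def)
  then show ?thesis
    unfolding degree_def using assms
    by (subst card_Un_disjoint[symmetric]) (auto simp: simple_graph_def)
qed

lemma sorted_degrees_join:
  assumes "simple_graph G" "simple_graph H" "verts G \<inter> verts H = {}"
    and "set p \<subseteq> verts G" "sorted (map (degree G) p)"
  shows "sorted (map (degree (join G H)) p)"
  unfolding sorted_wrt_map
\<comment> \<open>The degrees need comparing only at vertices of \<open>p\<close>; there the join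
  shifts all of them by the same constant.\<close>
proof (rule sorted_wrt_mono_rel)
  show "sorted_wrt (\<lambda>x y. degree G x \<le> degree G y) p"
    using assms(5) by (simp add: sorted_wrt_map)
qed (simp add: degree_join[OF assms(1-3)] subsetD[OF assms(4)])

lemma mp_join_ge:
  assumes G: "simple_graph G" and H: "simple_graph H" and disj: "verts G \<inter> verts H = {}"
  shows "mp G + mp H \<le> mp (join G H)"
proof -
  let ?d = "degree (join G H)"
  obtain p where p: "path G p" "sorted (map (degree G) p)" "length p = mp G"
    using mp_attained[OF G] .
  obtain q where q: "path H q" "sorted (map (degree H) q)" "length q = mp H"
    using mp_attained[OF H] .
  have sub: "set p \<subseteq> verts G" "set q \<subseteq> verts H"
    using p q by (auto simp: path_def)
  have "sorted (map ?d p)"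
    using sorted_degrees_join[OF G H disj] sub p by blast
  \<comment> \<open>The same lemma with the roles of \<open>G\<close> and \<open>H\<close>
    exchanged, as the join is symmetric.\<close>
  moreover have "sorted (map ?d q)"
    using sorted_degrees_join[OF H G] disj sub q by (simp add: join_commute Int_commute)
  ultimately obtain zs where zs: "zs \<in> shuffles p q" "sorted (map ?d zs)"
    using exists_sorted_shuffle by blast
  have "successively (adj (join G H)) zs"
  proof (rule successively_shuffles[OF zs(1)])
    show "successively (adj (join G H)) p" "successively (adj (join G H)) q"
      using p(1) q(1) by (auto simp: path_def adj_join elim: successively_mono)
  qed (use sub in \<open>auto simp: adj_join\<close>)
  moreover have "distinct zs"
    using distinct_disjoint_shuffles[OF _ _ _ zs(1)] p q sub disj by (auto simp: path_def)
  moreover have "set zs \<subseteq> verts (join G H)"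
    using set_shuffles[OF zs(1)] sub by (auto simp: join_def)
  moreover have "zs \<noteq> []"
    using zs(1) p(1) by (auto simp: path_def)
  ultimately have "degree_monotone_path (join G H) zs"
    using zs(2) by (simp add: degree_monotone_path_def path_def)
  then have "length zs \<le> mp (join G H)"
    using length_le_mp simple_graph_join[OF G H disj] by blast
  then show ?thesis
    using length_shuffles[OF zs(1)] p(3) q(3) by simp
qed

lemma mp_join_le:
  assumes "simple_graph G" "simple_graph H" "verts G \<inter> verts H = {}"
  shows "mp (join G H) \<le> card (verts G) + card (verts H)"
proof -
  have "mp (join G H) \<le> card (verts (join G H))"
    by (rule mp_le_card_verts[OF simple_graph_join[OF assms]])
  also have "\<dots> \<le> card (verts G) + card (verts H)"
    by (simp add: join_def card_Un_le)
  finally show ?thesis .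
qed

theorem theorem4p2:
  shows
    "(\<forall>G H :: 'a graph.
        simple_graph G \<and> simple_graph H \<and> verts G \<inter> verts H = {} \<longrightarrow>
          mp G + mp H \<le> mp (join G H) \<and>
          mp (join G H) \<le> card (verts G) + card (verts H)) \<and>
     (\<exists>G H :: nat graph.
        simple_graph G \<and> simple_graph H \<and> verts G \<inter> verts H = {} \<and>
          mp G + mp H = mp (join G H)) \<and>
     (\<exists>G H :: nat graph.
        simple_graph G \<and> simple_graph H \<and> verts G \<inter> verts H = {} \<and>
          mp (join G H) = card (verts G) + card (verts H))"
proof -
  define K :: "nat \<Rightarrow> nat graph" where "K v = \<lparr>verts = {v}, edges = {}\<rparr>" for v
  have K: "simple_graph (K v)" "card (verts (K v)) = 1" for v
    by (simp_all add: K_def simple_graph_def)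
  have disj: "verts (K 0) \<inter> verts (K 1) = {}"
    by (simp add: K_def)
  \<comment> \<open>No value of \<open>mp\<close> is computed: each \<open>mp (K v)\<close> is at
    least 1, so the lower bound is at least 2, while the upper bound is 1 + 1. This squeeze turns
    both inequalities into equalities.\<close>
  have "mp (K 0) + mp (K 1) = mp (join (K 0) (K 1)) \<and>
      mp (join (K 0) (K 1)) = card (verts (K 0)) + card (verts (K 1))"
    using mp_join_ge[OF K(1) K(1) disj] mp_join_le[OF K(1) K(1) disj]
      mp_pos[OF K(1), of 0] mp_pos[OF K(1), of 1]
    unfolding K(2) by linarith
  then show ?thesis
    using K(1) disj mp_join_ge mp_join_le by blast
qed

end
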